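(* Let $a,b,d\in\mathbb{R}$, let $L_S=\operatorname{diag}(1,-1)$ and $V=\begin{pmatrix}a&b\\-b&d\end{pmatrix}$, and for $(u,\lambda)\in\mathbb{C}^2$ with $u\neq0$ put \[A(u;\lambda)=u^2 I_2-L_S-\lambda u^{-1}V,\qquad R(u,\lambda)=A(u;\lambda)^{-1}\ \text{(when invertible)}.\] Set $\tau=a+d$, $\delta=a-d$, $\Delta=ad+b^2$. Let $E/\mathbb{Q}$ be an elliptic curve, $p$ a prime of good reduction for $E$, and $a_p=p+1-\#E(\mathbb{F}_p)$. Define \[A_0=\tau^2-4\Delta,\qquad B=-\frac{a_pA_0}{p}+2\delta\tau,\qquad C=\tau^2-\frac{a_p\delta\tau}{p}-\frac{\Delta a_p^2}{p^2}+\frac{\tau^2}{p}.\] Then there exists a basepoint $(u_p,\lambda_p)\in\mathbb{C}^2$ at which $A(u_p;\lambda_p)$ is invertible and \[\det\bigl(I_2-p^{-s}R(u_p,\lambda_p)\bigr)=1-a_pp^{-s}+p^{1-2s}\quad\text{for all }s\in\mathbb{C};\] the basepoint is given by the solution of $A_0Y^2+BY+C=0$ with $Y=u^2$, namely \[u_p^2=\frac{-B+\sqrt{B^2-4A_0C}}{2A_0},\qquad \lambda_p=\frac{2u_p^3}{\tau}-\frac{a_pu_p}{p\tau}.\]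
   Context: The pencil $A(u;\lambda)$ is called a $2\times2$ $J$-self-adjoint causal pencil (with fundamental symmetry $J=\operatorname{diag}(1,-1)$, variable $u=z^{1/2}$ on the double cover of the $z$-plane). In the paper the quadratic coefficient is denoted $A$; it is renamed $A_0$ here to avoid a clash with the pencil.
   Formalization: The formal theorem additionally assumes τ ≠ 0, A_0 ≠ 0 and that the displayed value of u_p² (with the principal complex square root) is nonzero; otherwise the formulas divide by zero or give u_p = 0, where the pencil is undefined. *)

theory Defs
  imports "HOL-Analysis.Analysis" "HOL-Computational_Algebra.Primes" "HOL-Number_Theory.Cong"
begin

section \<open>Elliptic curves over the rationals and their reductions\<close>

text \<open>The equation \<open>y\<^sup>2 + a1 x y + a3 y = x\<^sup>3 + a2 x\<^sup>2 + a4 x + a6\<close>.\<close>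

record 'a weierstrass =
  wa1 :: 'a
  wa2 :: 'a
  wa3 :: 'a
  wa4 :: 'a
  wa6 :: 'a

definition weierstrass_disc :: "'a::comm_ring_1 weierstrass \<Rightarrow> 'a" where
  "weierstrass_disc W =
     (let b2 = (wa1 W)^2 + 4 * wa2 W;
          b4 = 2 * wa4 W + wa1 W * wa3 W;
          b6 = (wa3 W)^2 + 4 * wa6 W;
          b8 = (wa1 W)^2 * wa6 W + 4 * wa2 W * wa6 W - wa1 W * wa3 W * wa4 W
               + wa2 W * (wa3 W)^2 - (wa4 W)^2
      in - (b2^2 * b8) - 8 * b4^3 - 27 * b6^2 + 9 * b2 * b4 * b6)"

definition elliptic_curve :: "'a::field weierstrass \<Rightarrow> bool" where
  "elliptic_curve E \<longleftrightarrow> weierstrass_disc E \<noteq> 0"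

text \<open>Isomorphism over the base field, by an admissible change of variables
  \<open>x = v\<^sup>2 x' + r\<close>, \<open>y = v\<^sup>3 y' + s v\<^sup>2 x' + t\<close>.\<close>

definition weierstrass_iso :: "'a::field weierstrass \<Rightarrow> 'a weierstrass \<Rightarrow> bool" where
  "weierstrass_iso E E' \<longleftrightarrow>
     (\<exists>v r s t. v \<noteq> 0 \<and>
        v * wa1 E' = wa1 E + 2 * s \<and>
        v^2 * wa2 E' = wa2 E - s * wa1 E + 3 * r - s^2 \<and>
        v^3 * wa3 E' = wa3 E + r * wa1 E + 2 * t \<and>
        v^4 * wa4 E' = wa4 E - s * wa3 E + 2 * r * wa2 E - (t + r * s) * wa1 E
                       + 3 * r^2 - 2 * s * t \<and>
        v^6 * wa6 E' = wa6 E + r * wa4 E + r^2 * wa2 E + r^3 - t * wa3 E - t^2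
                       - r * t * wa1 E)"

definition rat_weierstrass :: "int weierstrass \<Rightarrow> rat weierstrass" where
  "rat_weierstrass W =
     \<lparr>wa1 = of_int (wa1 W), wa2 = of_int (wa2 W), wa3 = of_int (wa3 W),
      wa4 = of_int (wa4 W), wa6 = of_int (wa6 W)\<rparr>"

text \<open>A model of \<open>E\<close> whose reduction modulo \<open>p\<close> is nonsingular. Requiring coefficients in
  \<open>\<int>\<close> rather than in \<open>\<int>\<^sub>(\<^sub>p\<^sub>)\<close> loses no curves: scaling by a \<open>v\<close> prime to \<open>p\<close>
  clears the remaining denominators and changes the discriminant by a \<open>p\<close>-unit.\<close>

definition good_model :: "rat weierstrass \<Rightarrow> nat \<Rightarrow> int weierstrass \<Rightarrow> bool" where
  "good_model E p W \<longleftrightarrow>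
     weierstrass_iso E (rat_weierstrass W) \<and> \<not> int p dvd weierstrass_disc W"

definition good_reduction :: "rat weierstrass \<Rightarrow> nat \<Rightarrow> bool" where
  "good_reduction E p \<longleftrightarrow> (\<exists>W. good_model E p W)"

text \<open>The points over \<open>\<bbbF>\<^sub>p\<close> of the projective curve given by \<open>W\<close> modulo \<open>p\<close>, with
  \<open>\<bbbF>\<^sub>p\<close> represented by \<open>{0..<p}\<close> and the point at infinity by \<^term>\<open>None\<close>.\<close>

definition points_mod :: "int weierstrass \<Rightarrow> nat \<Rightarrow> (int \<times> int) option set" where
  "points_mod W p =
     insert None (Some ` {(x, y). x \<in> {0..<int p} \<and> y \<in> {0..<int p} \<and>
       [y^2 + wa1 W * x * y + wa3 W * y = x^3 + wa2 W * x^2 + wa4 W * x + wa6 W] (mod int p)})"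

text \<open>The count does not depend on the chosen model: any two good models at \<open>p\<close> have
  reductions that are isomorphic over \<open>\<bbbF>\<^sub>p\<close>.\<close>

definition frobenius_trace :: "rat weierstrass \<Rightarrow> nat \<Rightarrow> int" where
  "frobenius_trace E p = int p + 1 - int (card (points_mod (SOME W. good_model E p W) p))"


section \<open>The causal pencil\<close>

definition L_S :: "complex^2^2" where
  "L_S = vector [vector [1, 0], vector [0, -1]]"

definition V_mat :: "real \<Rightarrow> real \<Rightarrow> real \<Rightarrow> complex^2^2" where
  "V_mat a b d = vector [vector [of_real a, of_real b], vector [- of_real b, of_real d]]"

text \<open>Here \<^term>\<open>mat c\<close> is \<open>c I\<^sub>2\<close>, so multiplying by it is scalar multiplication. The value at
  \<open>u = 0\<close> is an artefact of \<open>inverse 0 = 0\<close>; the pencil is meant for \<open>u \<noteq> 0\<close> only.\<close>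

definition pencil :: "real \<Rightarrow> real \<Rightarrow> real \<Rightarrow> complex \<Rightarrow> complex \<Rightarrow> complex^2^2" where
  "pencil a b d u l = mat (u^2) - L_S - mat (l * inverse u) ** V_mat a b d"

definition pencil_resolvent :: "real \<Rightarrow> real \<Rightarrow> real \<Rightarrow> complex \<Rightarrow> complex \<Rightarrow> complex^2^2" where
  "pencil_resolvent a b d u l = matrix_inv (pencil a b d u l)"

end

theory Submission
  imports Defs
begin

text \<open>For an invertible \<open>2 \<times> 2\<close> matrix \<open>M\<close> the polynomial \<open>det (I - x M\<^sup>-\<^sup>1)\<close> equals
  \<open>1 - (tr M / det M) x + x\<^sup>2 / det M\<close>. So the basepoint has to satisfy \<open>tr A = a\<^sub>p / p\<close> and
  \<open>det A = 1 / p\<close>. The first equation is linear in \<open>\<lambda>\<close> and is solved by the stated \<open>\<lambda>\<^sub>p\<close>;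
  substituting it into the second and multiplying by \<open>-\<tau>\<^sup>2\<close> gives \<open>A\<^sub>0 Y\<^sup>2 + B Y + C = 0\<close>.\<close>

lemma matrix_diff_rdistrib:
  fixes A B :: "'a::ring_1^'n^'m"
  shows "(A - B) ** C = A ** C - B ** C"
  by (vector matrix_matrix_mult_def sum_subtractf left_diff_distrib)

lemma det_minus_mat_2:
  fixes M :: "'a::comm_ring_1^2^2"
  shows "det (M - mat x) = det M - x * trace M + x^2"
  by (simp add: det_2 trace_def sum_2 mat_def algebra_simps power2_eq_square)

text \<open>Multiplying by \<open>M\<close> on the right turns the matrix into
  \<open>M - mat x\<close>, so its determinant is the characteristic polynomial of \<open>M\<close>
  at \<open>x\<close>, divided by \<open>det M\<close>.\<close>

lemma det_one_minus_mat_mult_inverse_2: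
  fixes M :: "'a::field^2^2"
  assumes "invertible M"
  shows "det (mat 1 - mat x ** matrix_inv M) = 1 - (trace M / det M) * x + x^2 / det M"
proof -
  have nz: "det M \<noteq> 0"
    using assms by (simp add: invertible_det_nz)
  have inv: "matrix_inv M ** M = mat 1"
    using assms unfolding invertible_def matrix_inv_def by (metis (mono_tags, lifting) someI_ex)
  have "(mat 1 - mat x ** matrix_inv M) ** M = M - mat x ** (matrix_inv M ** M)"
    by (simp add: matrix_mul_assoc matrix_diff_rdistrib)
  then have "(mat 1 - mat x ** matrix_inv M) ** M = M - mat x"
    by (simp add: inv)
  then have "det (mat 1 - mat x ** matrix_inv M) * det M = det M - x * trace M + x^2"
    by (metis det_mul det_minus_mat_2)
  then show ?thesis
    using nz by (simp add: field_simps)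
qed

lemma pencil_entries:
  "pencil a b d u l $ 1 $ 1 = u^2 - 1 - l / u * of_real a"
  "pencil a b d u l $ 1 $ 2 = - (l / u * of_real b)"
  "pencil a b d u l $ 2 $ 1 = l / u * of_real b"
  "pencil a b d u l $ 2 $ 2 = u^2 + 1 - l / u * of_real d"
  by (simp_all add: pencil_def L_S_def V_mat_def mat_def matrix_matrix_mult_def sum_2
      divide_inverse)

lemma trace_pencil: "trace (pencil a b d u l) = 2 * u^2 - l / u * of_real (a + d)"
  by (simp add: trace_def sum_2 pencil_entries algebra_simps)

lemma det_pencil:
  "det (pencil a b d u l) =
     (u^2)^2 - 1 - l / u * (of_real (a + d) * u^2 + of_real (a - d))
       + (l / u)^2 * of_real (a * d + b^2)"
proof -
  \<comment> \<open>Free complex variables keep \<open>of_real\<close> and the quotient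
    \<open>l / u\<close> out of the ring normalisation. The opposite signs of the off-diagonal
    entries produce \<open>+ b'^2\<close>.\<close>
  have "(y - 1 - m * a') * (y + 1 - m * d') - - (m * b') * (m * b') =
      y^2 - 1 - m * ((a' + d') * y + (a' - d')) + m^2 * (a' * d' + b'^2)"
    for y m a' b' d' :: complex
    by (simp add: algebra_simps power2_eq_square)
  then show ?thesis
    by (simp only: det_2 pencil_entries of_real_add of_real_diff of_real_mult of_real_power)
qed

text \<open>Completing the square: \<open>2 * a * y + b\<close> squares to the discriminant.\<close>

lemma quadratic_root_csqrt:
  fixes a b c :: complex
  assumes "a \<noteq> 0" and "y = (- b + csqrt (b^2 - 4 * a * c)) / (2 * a)"
  shows "a * y^2 + b * y + c = 0"
proof -
  have "2 * a * y + b = csqrt (b^2 - 4 * a * c)"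
    using assms by (simp add: field_simps)
  then have "(2 * a * y + b)^2 = b^2 - 4 * a * c"
    by simp
  then have "4 * a * (a * y^2 + b * y + c) = 0"
    by (simp add: algebra_simps power2_eq_square)
  then show ?thesis
    using assms(1) by simp
qed

text \<open>The stated formulas divide by \<open>\<tau>\<close> and \<open>A\<^sub>0\<close>, and
  the pencil is meant for nonzero \<open>u\<close> only, which forces \<open>Y \<noteq> 0\<close>;
  hence the last three assumptions.\<close>

theorem mainTheorem1:
  fixes a b d :: real and E :: "rat weierstrass" and p :: nat
    and ap \<tau> \<delta> \<Delta> A\<^sub>0 B C :: real and Y :: complex
  assumes "elliptic_curve E" and "prime p" and "good_reduction E p"
  defines "ap \<equiv> real_of_int (frobenius_trace E p)"
  defines "\<tau> \<equiv> a + d" and "\<delta> \<equiv> a - d" and "\<Delta> \<equiv> a * d + b^2"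
  defines "A\<^sub>0 \<equiv> \<tau>^2 - 4 * \<Delta>"
    and "B \<equiv> - (ap * A\<^sub>0 / real p) + 2 * \<delta> * \<tau>"
    and "C \<equiv> \<tau>^2 - ap * \<delta> * \<tau> / real p - \<Delta> * ap^2 / (real p)^2 + \<tau>^2 / real p"
  defines "Y \<equiv> (- of_real B + csqrt (of_real (B^2 - 4 * A\<^sub>0 * C))) / (2 * of_real A\<^sub>0)"
  assumes "\<tau> \<noteq> 0" and "A\<^sub>0 \<noteq> 0" and "Y \<noteq> 0"
  shows "\<exists>u\<^sub>p l\<^sub>p :: complex.
           u\<^sub>p \<noteq> 0 \<and>
           invertible (pencil a b d u\<^sub>p l\<^sub>p) \<and>
           (\<forall>s :: complex.
              det (mat 1 - mat (of_nat p powr (- s)) ** pencil_resolvent a b d u\<^sub>p l\<^sub>p)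
                = 1 - of_real ap * of_nat p powr (- s) + of_nat p powr (1 - 2 * s)) \<and>
           of_real A\<^sub>0 * (u\<^sub>p^2)^2 + of_real B * u\<^sub>p^2 + of_real C = 0 \<and>
           u\<^sub>p^2 = Y \<and>
           l\<^sub>p = 2 * u\<^sub>p^3 / of_real \<tau> - of_real ap * u\<^sub>p / (of_nat p * of_real \<tau>)"
proof -
  have p0: "(of_nat p :: complex) \<noteq> 0"
    using \<open>prime p\<close> by (simp add: prime_gt_0_nat)
  have \<tau>0: "(of_real \<tau> :: complex) \<noteq> 0"
    using \<open>\<tau> \<noteq> 0\<close> by simp
  \<comment> \<open>Either square root would serve: \<open>l\<close> is odd in \<open>u\<close>, so
    the pencil depends on \<open>u\<close> only through \<open>u^2\<close> and the even quotient
    \<open>l / u\<close>.\<close>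
  define u where "u = csqrt Y"
  define t :: complex where "t = of_real ap / of_nat p"
  define l where "l = 2 * u^3 / of_real \<tau> - of_real ap * u / (of_nat p * of_real \<tau>)"
  define M where "M = pencil a b d u l"
  have u0: "u \<noteq> 0" and uY: "u^2 = Y"
    using \<open>Y \<noteq> 0\<close> by (simp_all add: u_def)
  have quad: "of_real A\<^sub>0 * Y^2 + of_real B * Y + of_real C = 0"
    by (rule quadratic_root_csqrt) (use \<open>A\<^sub>0 \<noteq> 0\<close> in \<open>simp_all add: Y_def\<close>)
  have m: "l / u * of_real \<tau> = 2 * Y - t"
    using u0 p0 \<tau>0
    by (simp add: l_def t_def flip: uY) (simp add: field_simps power2_eq_square power3_eq_cube)
  have trM: "trace M = t"
    using m by (simp add: M_def trace_pencil uY \<tau>_def del: of_real_add)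
  have detM: "det M = 1 / of_nat p"
  proof -
    define m' where "m' = l / u"
    let ?\<tau> = "of_real \<tau> :: complex" and ?\<delta> = "of_real \<delta> :: complex"
      and ?D = "of_real \<Delta> :: complex"
    have m': "m' * ?\<tau> = 2 * Y - t"
      using m by (simp add: m'_def)
    \<comment> \<open>After scaling by \<open>\<tau>^2\<close>, \<open>m'\<close> occurs only in the
      product \<open>m' * \<tau>\<close>, which is known to be \<open>2 * Y - t\<close>.\<close>
    have "?\<tau>^2 * (Y^2 - 1 - m' * (?\<tau> * Y + ?\<delta>) + m'^2 * ?D) =
        ?\<tau>^2 * Y^2 - ?\<tau>^2 - (m' * ?\<tau>) * (?\<tau>^2 * Y + ?\<delta> * ?\<tau>) + (m' * ?\<tau>)^2 * ?D"
      by (simp add: algebra_simps power2_eq_square)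
    \<comment> \<open>Expanding in powers of \<open>Y\<close> gives the coefficients
      \<open>-A\<^sub>0\<close>, \<open>-B\<close> and \<open>\<tau>^2 / p - C\<close>; the summand
      \<open>\<tau>^2 / p\<close> of \<open>C\<close> encodes the target determinant
      \<open>1 / p\<close>.\<close>
    also have "\<dots> = ?\<tau>^2 / of_nat p - (of_real A\<^sub>0 * Y^2 + of_real B * Y + of_real C)"
      unfolding m' using p0
      by (simp add: A\<^sub>0_def B_def C_def t_def field_simps power2_eq_square)
    also have "\<dots> = ?\<tau>^2 * (1 / of_nat p)"
      by (simp add: quad)
    finally have "Y^2 - 1 - m' * (?\<tau> * Y + ?\<delta>) + m'^2 * ?D = 1 / of_nat p"
      using \<tau>0 by (simp only: mult_left_cancel power_eq_0_iff not_False_eq_True simp_thms)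
    then show ?thesis
      by (simp only: M_def det_pencil uY m'_def \<tau>_def \<delta>_def \<Delta>_def)
  qed
  have inv: "invertible M"
    using detM p0 by (simp add: invertible_det_nz)
  have "det (mat 1 - mat (of_nat p powr (- s)) ** pencil_resolvent a b d u l)
      = 1 - of_real ap * of_nat p powr (- s) + of_nat p powr (1 - 2 * s)" for s :: complex
  proof -
    \<comment> \<open>With \<open>x = p powr (- s)\<close>, this is the term
      \<open>x^2 / det M = p * x^2\<close>, while \<open>trace M / det M = t * p\<close> is
      \<open>ap\<close>.\<close>
    have "of_nat p powr (1 - 2 * s) = of_nat p powr (1 + (- s + - s))"
      by (simp add: algebra_simps)
    also have "\<dots> = of_nat p * (of_nat p powr (- s))^2"
      unfolding powr_add using p0 by (simp add: power2_eq_square)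
    finally show ?thesis
      using det_one_minus_mat_mult_inverse_2[OF inv, of "of_nat p powr (- s)"] p0
      by (simp add: pencil_resolvent_def trM detM t_def flip: M_def)
  qed
  then show ?thesis
    using u0 uY inv quad by (intro exI[of _ u] exI[of _ l]) (simp add: M_def l_def)
qed

end
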